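(* For every integer $k \geq 3$ there exists a graph $G$ such that, if $P$ is a minimum-size solution of \textsc{PAU-VC} on $G$ and $M$ is a minimum-size solution of \textsc{MU-VC} on $G$, then $|P| \geq k$ and $|M| = 2$.
   Context: All graphs are finite, simple, undirected, without loops. A vertex cover of a graph $G$ is a set of vertices intersecting every edge; a minimum vertex cover is one of smallest cardinality. For $S \subseteq V(G)$, $G - S$ is the subgraph induced by $V(G)\setminus S$. A solution of \textsc{Pre-Assignment for Unification of Minimum Vertex Cover} (\textsc{PAU-VC}) on $G$ is a set $S \subseteq V(G)$ such that there is exactly one minimum vertex cover of $G$ that contains $S$. A solution of \textsc{Modulator to Unique Minimum Vertex Cover} (\textsc{MU-VC}) on $G$ is a set $S \subseteq V(G)$ such that $G - S$ has a unique minimum vertex cover. A minimum-size solution is a solution of smallest cardinality. *)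

theory Defs
  imports Main
begin

type_synonym 'a graph = "'a set \<times> 'a set set"

abbreviation verts :: "'a graph \<Rightarrow> 'a set" where
  "verts G \<equiv> fst G"

abbreviation edges :: "'a graph \<Rightarrow> 'a set set" where
  "edges G \<equiv> snd G"

definition finite_simple_graph :: "'a graph \<Rightarrow> bool" where
  "finite_simple_graph G \<longleftrightarrow>
     finite (verts G) \<and> (\<forall>e \<in> edges G. e \<subseteq> verts G \<and> card e = 2)"

definition delete_verts :: "'a graph \<Rightarrow> 'a set \<Rightarrow> 'a graph" where
  "delete_verts G S = (verts G - S, {e \<in> edges G. e \<subseteq> verts G - S})"

definition vertex_cover :: "'a graph \<Rightarrow> 'a set \<Rightarrow> bool" where
  "vertex_cover G C \<longleftrightarrow> C \<subseteq> verts G \<and> (\<forall>e \<in> edges G. e \<inter> C \<noteq> {})"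

definition minimum_vertex_cover :: "'a graph \<Rightarrow> 'a set \<Rightarrow> bool" where
  "minimum_vertex_cover G C \<longleftrightarrow> is_arg_min card (vertex_cover G) C"

(* The cover containing S has minimum size among all vertex covers of G,
   not merely among those that contain S. *)
definition pau_vc_solution :: "'a graph \<Rightarrow> 'a set \<Rightarrow> bool" where
  "pau_vc_solution G S \<longleftrightarrow>
     S \<subseteq> verts G \<and> (\<exists>!C. minimum_vertex_cover G C \<and> S \<subseteq> C)"

definition mu_vc_solution :: "'a graph \<Rightarrow> 'a set \<Rightarrow> bool" where
  "mu_vc_solution G S \<longleftrightarrow>
     S \<subseteq> verts G \<and> (\<exists>!C. minimum_vertex_cover (delete_verts G S) C)"

definition minimum_pau_vc_solution :: "'a graph \<Rightarrow> 'a set \<Rightarrow> bool" where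
  "minimum_pau_vc_solution G P \<longleftrightarrow> is_arg_min card (pau_vc_solution G) P"

definition minimum_mu_vc_solution :: "'a graph \<Rightarrow> 'a set \<Rightarrow> bool" where
  "minimum_mu_vc_solution G M \<longleftrightarrow> is_arg_min card (mu_vc_solution G) M"

end

theory Submission
  imports Defs
begin

text \<open>
  Take a hub with two pendant leaves and \<open>k\<close> legs of length two. A minimum vertex cover consists of
  the hub and one end of the outer edge of each leg, and these \<open>k\<close> choices are independent, so a
  preassignment must meet every leg. Deleting both leaves makes the hub unprofitable, and the inner
  leg vertices then form the only minimum cover. After deleting at most one vertex, the hub still
  belongs to some minimum cover unless it is deleted itself, and an untouched leg can be flipped.
\<close>

text \<open>
  The hub is \<open>0\<close>, its leaves are \<open>1\<close> and \<open>2\<close>, and leg \<open>i\<close> is the path \<open>0\<close>, \<open>2 * i + 3\<close>, \<open>2 * i + 4\<close>.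
\<close>

definition spider :: "nat \<Rightarrow> nat graph" where
  "spider k = ({..<2 * k + 3},
     {{0, 1}, {0, 2}} \<union> (\<lambda>i. {0, 2 * i + 3}) ` {..<k} \<union> (\<lambda>i. {2 * i + 3, 2 * i + 4}) ` {..<k})"

lemma finite_simple_graph_spider: "finite_simple_graph (spider k)"
  by (auto simp: finite_simple_graph_def spider_def)

text \<open>Lets the facts about covers after deletion be used at \<open>S = {}\<close>, for the
  PAU-VC bound.\<close>

lemma delete_verts_empty:
  assumes "finite_simple_graph G"
  shows "delete_verts G {} = G"
  using assms by (auto simp: delete_verts_def finite_simple_graph_def intro: prod_eqI)

text \<open>An edge disappears exactly when it meets \<open>S\<close>, so deleted vertices act like
  cover vertices that cost nothing.\<close>

lemma vertex_cover_delete_verts_iff: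
  assumes "finite_simple_graph G"
  shows "vertex_cover (delete_verts G S) C \<longleftrightarrow>
    C \<subseteq> verts G - S \<and> (\<forall>e \<in> edges G. e \<inter> (C \<union> S) \<noteq> {})"
proof -
  have "e \<inter> (C \<union> S) \<noteq> {} \<longleftrightarrow> (e \<subseteq> verts G - S \<longrightarrow> e \<inter> C \<noteq> {})" if "e \<in> edges G" for e
  proof -
    have "e \<subseteq> verts G"
      using assms that by (simp add: finite_simple_graph_def)
    then show ?thesis by blast
  qed
  then show ?thesis
    by (simp add: Ball_def imp_conjL vertex_cover_def delete_verts_def)
qed

lemma vertex_cover_spider_iff:
  "vertex_cover (delete_verts (spider k) S) C \<longleftrightarrow>
    C \<subseteq> {..<2 * k + 3} - S \<and>
    (0 \<in> C \<union> S \<or> 1 \<in> C \<union> S \<and> 2 \<in> C \<union> S \<and> (\<forall>i<k. 2 * i + 3 \<in> C \<union> S)) \<and>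
    (\<forall>i<k. 2 * i + 3 \<in> C \<union> S \<or> 2 * i + 4 \<in> C \<union> S)"
proof -
  have meets: "(\<forall>e \<in> edges (spider k). e \<inter> T \<noteq> {}) \<longleftrightarrow>
      (0 \<in> T \<or> 1 \<in> T \<and> 2 \<in> T \<and> (\<forall>i<k. 2 * i + 3 \<in> T)) \<and>
      (\<forall>i<k. 2 * i + 3 \<in> T \<or> 2 * i + 4 \<in> T)" for T
    by (auto simp: spider_def ball_Un)
  show ?thesis
    unfolding vertex_cover_delete_verts_iff[OF finite_simple_graph_spider] meets
    by (simp add: spider_def)
qed

lemma minimum_vertex_cover_iff:
  "minimum_vertex_cover G C \<longleftrightarrow>
    vertex_cover G C \<and> (\<forall>D. vertex_cover G D \<longrightarrow> card C \<le> card D)"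
  by (auto simp: minimum_vertex_cover_def is_arg_min_linorder)

lemma finite_vertex_cover_spider:
  "vertex_cover (delete_verts (spider k) S) C \<Longrightarrow> finite C"
  by (auto simp: vertex_cover_spider_iff intro: finite_subset[of _ "{..<2 * k + 3}"])

text \<open>With the hub in the cover or deleted, only the outer edge of leg \<open>j\<close> still
  needs covering, and its two ends do so equally well.\<close>

lemma minimum_vertex_cover_flip_leg:
  assumes C: "minimum_vertex_cover (delete_verts (spider k) S) C"
    and hub: "0 \<in> C \<union> S"
    and j: "j < k" "2 * j + 3 \<notin> S" "2 * j + 4 \<notin> S"
  obtains D where "minimum_vertex_cover (delete_verts (spider k) S) D" "D \<noteq> C"
    "C - {2 * j + 3, 2 * j + 4} \<subseteq> D"
proof -
  let ?x = "2 * j + 3" and ?y = "2 * j + 4"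
  have cov: "vertex_cover (delete_verts (spider k) S) C"
    and min: "\<And>D. vertex_cover (delete_verts (spider k) S) D \<Longrightarrow> card C \<le> card D"
    using C by (auto simp: minimum_vertex_cover_iff)
  have fin: "finite C"
    using cov by (rule finite_vertex_cover_spider)
  \<comment> \<open>Used twice: to show that \<open>C\<close> holds only one end, and to build the
    flipped cover.\<close>
  have flip: "vertex_cover (delete_verts (spider k) S) (insert z (C - {?x, ?y}))"
    if "z \<in> {?x, ?y}" for z
    unfolding vertex_cover_spider_iff
  proof (intro conjI allI impI)
    show "insert z (C - {?x, ?y}) \<subseteq> {..<2 * k + 3} - S"
      using cov j that unfolding vertex_cover_spider_iff by auto
    show "0 \<in> insert z (C - {?x, ?y}) \<union> S \<or> 1 \<in> insert z (C - {?x, ?y}) \<union> S \<and>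
        2 \<in> insert z (C - {?x, ?y}) \<union> S \<and> (\<forall>i<k. 2 * i + 3 \<in> insert z (C - {?x, ?y}) \<union> S)"
      using hub by auto
    fix i
    assume "i < k"
    show "2 * i + 3 \<in> insert z (C - {?x, ?y}) \<union> S \<or> 2 * i + 4 \<in> insert z (C - {?x, ?y}) \<union> S"
    proof (cases "i = j")
      case True
      then show ?thesis using that by auto
    next
      case False
      \<comment> \<open>Inner leg vertices are odd and outer ones even, so distinct legs are
        disjoint.\<close>
      then have "2 * i + 3 \<notin> {?x, ?y}" "2 * i + 4 \<notin> {?x, ?y}"
        by (simp_all; presburger)+
      moreover have "2 * i + 3 \<in> C \<union> S \<or> 2 * i + 4 \<in> C \<union> S"
        using cov \<open>i < k\<close> unfolding vertex_cover_spider_iff by blast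
      ultimately show ?thesis by blast
    qed
  qed
  have "?x \<in> C \<or> ?y \<in> C"
    using cov j unfolding vertex_cover_spider_iff by blast
  moreover have "\<not> (?x \<in> C \<and> ?y \<in> C)"
  proof
    assume both: "?x \<in> C \<and> ?y \<in> C"
    moreover have "?y \<notin> insert ?x (C - {?x, ?y})"
      by simp
    ultimately have "insert ?x (C - {?x, ?y}) \<subset> C"
      by blast
    then have "card (insert ?x (C - {?x, ?y})) < card C"
      using fin by (rule psubset_card_mono[rotated])
    moreover have "card C \<le> card (insert ?x (C - {?x, ?y}))"
      by (intro min flip) simp
    ultimately show False
      by linarith
  qed
  ultimately obtain z w where zw: "{z, w} = {?x, ?y}" "z \<noteq> w" "z \<in> C" "w \<notin> C"
  proof (cases "?x \<in> C")
    case True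
    then show thesis using \<open>\<not> (?x \<in> C \<and> ?y \<in> C)\<close> by (intro that[of ?x ?y]) auto
  next
    case False
    then show thesis using \<open>?x \<in> C \<or> ?y \<in> C\<close> by (intro that[of ?y ?x]) auto
  qed
  let ?D = "insert w (C - {?x, ?y})"
  have "C - {?x, ?y} = C - {z}"
    using zw by auto
  \<comment> \<open>Keeps \<open>card C - 1\<close> from truncating, so that adding \<open>w\<close>
    restores the size exactly.\<close>
  moreover have "card C > 0"
    using zw fin by (auto simp: card_gt_0_iff)
  ultimately have "card ?D = card C"
    using zw fin by (simp add: card_Diff_singleton)
  moreover have "vertex_cover (delete_verts (spider k) S) ?D"
    using zw by (intro flip) auto
  ultimately have "minimum_vertex_cover (delete_verts (spider k) S) ?D"
    using min by (auto simp: minimum_vertex_cover_iff)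
  then show thesis
    using zw by (intro that[of ?D]) auto
qed

text \<open>Without the hub, every remaining leaf must be in \<open>C\<close>, and the hub can
  replace them all. The trade saves a vertex if two leaves remain and ties if one does; the additive
  form avoids subtraction.\<close>

lemma vertex_cover_move_to_hub:
  assumes "vertex_cover (delete_verts (spider k) S) C" "0 \<notin> C \<union> S"
  shows "vertex_cover (delete_verts (spider k) S) (insert 0 (C - {1, 2}))"
    and "card (insert 0 (C - {1, 2})) + card ({1, 2} - S) = card C + 1"
proof -
  show "vertex_cover (delete_verts (spider k) S) (insert 0 (C - {1, 2}))"
    using assms unfolding vertex_cover_spider_iff by auto
  have fin: "finite C"
    using assms(1) by (rule finite_vertex_cover_spider)
  have leaves: "C \<inter> {1, 2} = {1, 2} - S"
    using assms unfolding vertex_cover_spider_iff by auto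
  have "card C = card (C - {1, 2}) + card (C \<inter> {1, 2})"
    using card_Int_Diff[OF fin, of "{1, 2}"] by simp
  then show "card (insert 0 (C - {1, 2})) + card ({1, 2} - S) = card C + 1"
    using assms(2) fin leaves by simp
qed

text \<open>The map \<open>(n - 3) div 2\<close> sends both ends of the outer edge of leg
  \<open>i\<close> to \<open>i\<close>. Leaving out \<open>0\<close> allows the hub to be counted on
  top.\<close>

lemma card_ge_if_meets_legs:
  assumes "finite C" "\<And>i. i < k \<Longrightarrow> 2 * i + 3 \<in> C \<or> 2 * i + 4 \<in> C"
  shows "k \<le> card (C - {0})"
proof -
  have "{..<k} \<subseteq> (\<lambda>n. (n - 3) div 2) ` (C - {0})"
  proof
    fix i assume "i \<in> {..<k}"
    then consider "2 * i + 3 \<in> C" | "2 * i + 4 \<in> C"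
      using assms(2) by auto
    then show "i \<in> (\<lambda>n. (n - 3) div 2) ` (C - {0})"
      by cases (force intro: rev_image_eqI)+
  qed
  then show ?thesis
    using surj_card_le[of "C - {0}" "{..<k}"] assms(1) by simp
qed

lemma card_pau_vc_solution_spider_ge:
  assumes "pau_vc_solution (spider k) P"
  shows "k \<le> card P"
proof -
  note del = delete_verts_empty[OF finite_simple_graph_spider]
  obtain C where C: "minimum_vertex_cover (spider k) C" "P \<subseteq> C"
    and uniq: "\<And>D. minimum_vertex_cover (spider k) D \<Longrightarrow> P \<subseteq> D \<Longrightarrow> D = C"
    using assms unfolding pau_vc_solution_def by blast
  have cov: "vertex_cover (delete_verts (spider k) {}) C"
    using C by (simp add: minimum_vertex_cover_iff del)
  \<comment> \<open>No leaf is deleted, so trading both for the hub would give a strictly smaller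
    cover.\<close>
  have hub: "0 \<in> C"
  proof (rule ccontr)
    assume "0 \<notin> C"
    then have "vertex_cover (spider k) (insert 0 (C - {1, 2}))"
      "card (insert 0 (C - {1, 2})) < card C"
      using vertex_cover_move_to_hub[OF cov] by (simp_all add: del)
    then show False
      using C(1) unfolding minimum_vertex_cover_iff by (meson not_le)
  qed
  \<comment> \<open>Flipping a leg that \<open>P\<close> misses would give a second minimum cover
    containing \<open>P\<close>.\<close>
  have "2 * i + 3 \<in> P \<or> 2 * i + 4 \<in> P" if "i < k" for i
  proof (rule ccontr)
    assume "\<not> (2 * i + 3 \<in> P \<or> 2 * i + 4 \<in> P)"
    moreover obtain D where "minimum_vertex_cover (spider k) D" "D \<noteq> C"
      "C - {2 * i + 3, 2 * i + 4} \<subseteq> D"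
      using minimum_vertex_cover_flip_leg[of k "{}" C i, unfolded del] C(1) hub \<open>i < k\<close> by blast
    ultimately show False
      using uniq[of D] C(2) by blast
  qed
  moreover have "finite P"
    using C(2) finite_vertex_cover_spider[OF cov] by (rule finite_subset)
  ultimately have "k \<le> card (P - {0})"
    by (intro card_ge_if_meets_legs)
  also have "\<dots> \<le> card P"
    using \<open>finite P\<close> by (intro card_mono) auto
  finally show ?thesis .
qed

lemma mu_vc_solution_spider_leaves: "mu_vc_solution (spider k) {1, 2}"
proof -
  let ?G = "delete_verts (spider k) {1, 2}"
  let ?X = "(\<lambda>i. 2 * i + 3) ` {..<k}"
  have card_X: "card ?X = k"
    by (subst card_image) (auto intro: inj_onI)
  have X: "vertex_cover ?G ?X"
    unfolding vertex_cover_spider_iff by auto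
  have lower: "k \<le> card (D - {0})" if "vertex_cover ?G D" for D
    using that finite_vertex_cover_spider[OF that]
    by (intro card_ge_if_meets_legs) (auto simp: vertex_cover_spider_iff)
  have "card (D - {0}) \<le> card D" if "vertex_cover ?G D" for D
    using finite_vertex_cover_spider[OF that] by (intro card_mono) auto
  then have "minimum_vertex_cover ?G ?X"
    using X lower card_X unfolding minimum_vertex_cover_iff by (metis le_trans)
  moreover have "D = ?X" if "minimum_vertex_cover ?G D" for D
  proof -
    have D: "vertex_cover ?G D" "card D \<le> k"
      using that X card_X unfolding minimum_vertex_cover_iff by metis+
    have fin: "finite D"
      using D(1) by (rule finite_vertex_cover_spider)
    \<comment> \<open>The legs alone use \<open>k\<close> vertices, so the hub would bring the size
      to at least \<open>k + 1\<close>.\<close>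
    have "0 \<notin> D"
      using lower[OF D(1)] D(2) fin card_Diff1_less[of D 0] by linarith
    \<comment> \<open>The edges at the missing hub force every inner leg vertex into
      \<open>D\<close>; these already number \<open>k\<close>.\<close>
    then have "?X \<subseteq> D"
      using D(1) unfolding vertex_cover_spider_iff by auto
    then show ?thesis
      using card_seteq[OF fin] D(2) card_X by metis
  qed
  ultimately show ?thesis
    unfolding mu_vc_solution_def by (auto simp: spider_def)
qed

text \<open>A single deletion spares a leaf and, as there are two legs, a whole leg. The leaf puts
  the hub in the cover unless it is deleted, and the spared leg then flips.\<close>

lemma card_mu_vc_solution_spider_ge:
  assumes S: "mu_vc_solution (spider k) S" and "k \<ge> 2"
  shows "2 \<le> card S"
proof (rule ccontr)
  assume "\<not> 2 \<le> card S"
  moreover have "finite S"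
    using S by (auto simp: mu_vc_solution_def spider_def intro: finite_subset)
  ultimately have "S = {} \<or> (\<exists>s. S = {s})"
    by (auto simp: card_1_singleton_iff less_2_cases_iff not_le)
  then obtain s where s: "S \<subseteq> {s}"
    by blast
  obtain C where C: "minimum_vertex_cover (delete_verts (spider k) S) C"
    and uniq: "\<And>D. minimum_vertex_cover (delete_verts (spider k) S) D \<Longrightarrow> D = C"
    using S unfolding mu_vc_solution_def by blast
  \<comment> \<open>With only one leaf left the trade may merely tie, so the contradiction comes
    from uniqueness of \<open>C\<close>, not from its minimality.\<close>
  have hub: "0 \<in> C \<union> S"
  proof (rule ccontr)
    assume hub: "0 \<notin> C \<union> S"
    let ?D = "insert 0 (C - {1, 2})"
    have "{1, 2} - S \<noteq> {}"
      using s by (cases "s = 1") auto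
    then have "card ({1, 2} - S) > 0"
      by (simp add: card_gt_0_iff)
    then have "vertex_cover (delete_verts (spider k) S) ?D" "card ?D \<le> card C"
      using vertex_cover_move_to_hub[of k S C] C hub by (auto simp: minimum_vertex_cover_iff)
    then have "minimum_vertex_cover (delete_verts (spider k) S) ?D"
      using C unfolding minimum_vertex_cover_iff by (meson le_trans)
    then show False
      using uniq hub by blast
  qed
  \<comment> \<open>Vertices \<open>3\<close> and \<open>4\<close> make up leg \<open>0\<close>; if
    \<open>s\<close> lies there, leg \<open>1\<close> is untouched.\<close>
  obtain j where "j < k" "2 * j + 3 \<notin> S" "2 * j + 4 \<notin> S"
  proof (cases "s \<in> {3, 4}")
    case True
    then show thesis using s \<open>k \<ge> 2\<close> by (intro that[of 1]) auto
  next
    case False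
    then show thesis using s \<open>k \<ge> 2\<close> by (intro that[of 0]) auto
  qed
  then obtain D where "minimum_vertex_cover (delete_verts (spider k) S) D" "D \<noteq> C"
    using minimum_vertex_cover_flip_leg[OF C hub] by metis
  then show False
    using uniq by blast
qed

theorem theorem1:
  fixes k :: nat
  assumes "k \<ge> 3"
  shows "\<exists>G :: nat graph. finite_simple_graph G \<and>
           (\<forall>P M. minimum_pau_vc_solution G P \<and> minimum_mu_vc_solution G M \<longrightarrow>
                  card P \<ge> k \<and> card M = 2)"
proof (intro exI[of _ "spider k"] conjI allI impI finite_simple_graph_spider; elim conjE)
  fix P
  assume "minimum_pau_vc_solution (spider k) P"
  then show "card P \<ge> k"
    by (auto simp: minimum_pau_vc_solution_def is_arg_min_def intro: card_pau_vc_solution_spider_ge)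
next
  fix M
  assume "minimum_mu_vc_solution (spider k) M"
  then have M: "mu_vc_solution (spider k) M"
    and "\<And>S. mu_vc_solution (spider k) S \<Longrightarrow> card M \<le> card S"
    by (auto simp: minimum_mu_vc_solution_def is_arg_min_linorder)
  from this(2)[OF mu_vc_solution_spider_leaves] have "card M \<le> 2"
    by simp
  moreover have "2 \<le> card M"
    using card_mu_vc_solution_spider_ge[OF M] assms by simp
  ultimately show "card M = 2"
    by simp
qed

end
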